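(* Let $q$ be a prime power and let $\mathbb{F}_q$ denote the field with $q$ elements. Fix a divisor $d>2$ of $q-1$, integers $u\ge 1$ and $k\ge 0$, an element $b\in\mathbb{F}_q$, and a polynomial $g\in\mathbb{F}_q[x]$ divisible by $h_d(x):=x^{d-1}+x^{d-2}+\dots+x+1$. Then \[ f(x) := x^u \left(b x^{k(q-1)/d} + g(x^{(q-1)/d})\right) \] permutes $\mathbb{F}_q$ if and only if the following four conditions hold: (1) $\gcd(u,(q-1)/d)=1$; (2) $\gcd(d, u+k(q-1)/d)=1$; (3) $b\ne 0$; (4) $1+g(1)/b$ is a $d$-th power in $\mathbb{F}_q^*$.
   Context: A polynomial $f\in\mathbb{F}_q[x]$ is said to permute $\mathbb{F}_q$ (is a permutation polynomial) if the map $\alpha\mapsto f(\alpha)$ is a bijection $\mathbb{F}_q\to\mathbb{F}_q$. *)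

theory Defs
  imports "HOL-Computational_Algebra.Polynomial" "HOL-Library.Cardinality"
begin

definition permutation_poly :: "'a::{field,finite} poly \<Rightarrow> bool" where
  "permutation_poly f \<longleftrightarrow> bij (poly f)"

definition h_poly :: "nat \<Rightarrow> 'a::{field,finite} poly" where
  "h_poly d = (\<Sum>i<d. monom 1 i)"

definition is_nonzero_power :: "nat \<Rightarrow> 'a::{field,finite} \<Rightarrow> bool" where
  "is_nonzero_power d a \<longleftrightarrow> (\<exists>c. c \<noteq> 0 \<and> a = c ^ d)"

end

theory Submission
  imports "HOL-Algebra.Algebraic_Closure_Type" Defs
begin

text \<open>
  Put \<open>s = (q - 1) div d\<close> and \<open>B = b + g(1)\<close>. Since \<open>g\<close> vanishes on the nontrivial \<open>d\<close>-th roots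
  of unity, a nonzero \<open>x\<close> is sent to \<open>b x\<^bsup>u + ks\<^esup>\<close> if \<open>x\<^bsup>s\<^esup> \<noteq> 1\<close> and to \<open>B x\<^bsup>u\<^esup>\<close> otherwise.
  Raising to the power \<open>s\<close>, the map \<open>f\<close> lies over a map on \<open>d\<close>-th roots of unity which is
  \<open>y \<mapsto> b\<^bsup>s\<^esup> y\<^bsup>u + ks\<^esup>\<close> away from \<open>1\<close> and \<open>1 \<mapsto> B\<^bsup>s\<^esup>\<close>. If \<open>f\<close> permutes the field, this map is
  onto, hence injective; as \<open>d > 2\<close>, a nontrivial common factor of \<open>d\<close> and \<open>u + ks\<close> would already
  identify two roots of unity different from \<open>1\<close>. So \<open>y \<mapsto> y\<^bsup>u + ks\<^esup>\<close> is itself bijective, and the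
  remaining value at \<open>1\<close> is forced: \<open>B\<^bsup>s\<^esup> = b\<^bsup>s\<^esup>\<close>, i.e. \<open>B / b\<close> is a \<open>d\<close>-th power.
\<close>

section \<open>The cyclic multiplicative group and its roots of unity\<close>

lemma two_le_card_field: "2 \<le> CARD('a::{field,finite})"
  using card_mono[of UNIV "{0, 1 :: 'a}"] by simp

text \<open>Carries cyclicity over from the algebraic structure to the type class; a generator of
  exact order \<open>CARD('a) - 1\<close> turns questions about powers into divisibility of
  exponents.\<close>

lemma finite_field_generator:
  obtains w :: "'a::{field,finite}"
  where "\<And>x. x \<noteq> 0 \<Longrightarrow> \<exists>i. x = w ^ i" "\<And>i. w ^ i = 1 \<longleftrightarrow> CARD('a) - 1 dvd i"
proof -
  define K where "K = (ring_of_type_algebra :: 'a ring)"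
  interpret K: field K
    unfolding K_def by (rule field_from_type_algebra)
  have K_simps [simp]: "carrier K = UNIV" "\<zero>\<^bsub>K\<^esub> = 0" "\<one>\<^bsub>K\<^esub> = 1" "(\<otimes>\<^bsub>K\<^esub>) = (*)"
    by (auto simp: K_def ring_of_type_algebra_def)
  let ?G = "Multiplicative_Group.mult_of K"
  interpret G: group ?G
    by (rule K.field_mult_group)
  have pow: "x [^]\<^bsub>K\<^esub> (i::nat) = x ^ i" for x i
    by (induction i) (auto simp: K.nat_pow_Suc2)
  have pow': "x [^]\<^bsub>?G\<^esub> (i::nat) = x ^ i" for x i
    by (simp add: pow Multiplicative_Group.nat_pow_mult_of)
  have order: "Coset.order ?G = CARD('a) - 1"
    by (simp add: K.order_mult_of Coset.order_def)
  obtain w where w: "w \<in> carrier ?G"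
    and gen: "carrier ?G = {w [^]\<^bsub>K\<^esub> i | i::nat. i \<in> UNIV}"
    using K.finite_field_mult_group_has_gen by auto
  have "carrier ?G = (\<lambda>i. w ^ i) ` {0..G.ord w - 1}"
    using G.ord_elems[OF _ w] gen by (simp add: pow pow' image_def Bex_def conj_commute)
  hence "Coset.order ?G \<le> card {0..G.ord w - 1}"
    unfolding Coset.order_def by (metis card_image_le finite_atLeastAtMost)
  hence "Coset.order ?G \<le> G.ord w"
    using G.ord_ge_1[OF _ w] by simp
  hence ord: "G.ord w = Coset.order ?G"
    using G.ord_le_group_order[OF _ w] by simp
  show thesis
  proof (rule that)
    show "\<exists>i. x = w ^ i" if "x \<noteq> 0" for x
      using gen that by (auto simp: pow)
    show "w ^ i = 1 \<longleftrightarrow> CARD('a) - 1 dvd i" for i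
      using G.pow_eq_id[OF w, of i] by (simp add: pow' ord order)
  qed
qed

lemma power_card_minus_1_eq_1:
  fixes x :: "'a::{field,finite}"
  assumes "x \<noteq> 0"
  shows "x ^ (CARD('a) - 1) = 1"
proof -
  obtain w :: 'a where w: "\<And>x. x \<noteq> 0 \<Longrightarrow> \<exists>i. x = w ^ i"
    "\<And>i. w ^ i = 1 \<longleftrightarrow> CARD('a) - 1 dvd i"
    using finite_field_generator by blast
  obtain i where "x = w ^ i" using w(1) assms by blast
  thus ?thesis by (simp flip: power_mult add: w(2))
qed

text \<open>For \<open>x = w ^ i\<close> with a generator \<open>w\<close>, \<open>x ^ s = 1\<close>
  says that \<open>d * s\<close> divides \<open>i * s\<close>, that is, \<open>d\<close> divides
  \<open>i\<close>.\<close>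

lemma power_eq_1_iff_is_nonzero_power:
  fixes x :: "'a::{field,finite}"
  assumes "CARD('a) - 1 = d * s"
  shows "x ^ s = 1 \<and> x \<noteq> 0 \<longleftrightarrow> is_nonzero_power d x"
proof
  assume x: "x ^ s = 1 \<and> x \<noteq> 0"
  obtain w :: 'a where w: "\<And>x. x \<noteq> 0 \<Longrightarrow> \<exists>i. x = w ^ i"
    "\<And>i. w ^ i = 1 \<longleftrightarrow> CARD('a) - 1 dvd i"
    using finite_field_generator by blast
  obtain i where i: "x = w ^ i" using w(1) x by blast
  have "s > 0" using two_le_card_field[where ?'a = 'a] assms by (cases s) auto
  have "d * s dvd i * s"
    using x by (simp add: i w(2)[unfolded assms] flip: power_mult)
  then obtain j where "i = d * j" using \<open>s > 0\<close> by auto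
  hence x_eq: "x = (w ^ j) ^ d" by (simp add: i mult.commute flip: power_mult)
  have "w \<noteq> 0"
    using w(2)[of "CARD('a) - 1"] two_le_card_field[where ?'a = 'a] by (auto simp: power_0_left)
  hence "w ^ j \<noteq> 0" by simp
  with x_eq show "is_nonzero_power d x"
    unfolding is_nonzero_power_def by blast
next
  assume "is_nonzero_power d x"
  then obtain c where "c \<noteq> 0" "x = c ^ d" unfolding is_nonzero_power_def by blast
  thus "x ^ s = 1 \<and> x \<noteq> 0"
    using power_card_minus_1_eq_1[of c] unfolding assms by (simp flip: power_mult)
qed

lemma ex_root_of_unity_neq_1:
  assumes "e dvd CARD('a) - 1" "e \<noteq> 1"
  obtains z :: "'a::{field,finite}" where "z ^ e = 1" "z \<noteq> 1"
proof -
  obtain w :: 'a where w: "\<And>i. w ^ i = 1 \<longleftrightarrow> CARD('a) - 1 dvd i"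
    using finite_field_generator by blast
  obtain t where t: "CARD('a) - 1 = e * t" using assms by blast
  have "t > 0" using two_le_card_field[where ?'a = 'a] t by (cases t) auto
  have "(w ^ t) ^ e = 1" by (simp add: w[unfolded t] mult.commute flip: power_mult)
  moreover have "w ^ t \<noteq> 1" using assms(2) \<open>t > 0\<close> by (auto simp: w[unfolded t])
  ultimately show thesis by (rule that)
qed

text \<open>\<open>w ^ t\<close> has exact order \<open>d > 2\<close>, so 1, \<open>w ^ t\<close>
  and its square are distinct; one of the last two differs from \<open>a\<close>.\<close>

lemma ex_root_of_unity_avoiding:
  assumes "d dvd CARD('a) - 1" "d > 2"
  obtains y :: "'a::{field,finite}" where "y ^ d = 1" "y \<noteq> 1" "y \<noteq> a"
proof -
  obtain w :: 'a where w: "\<And>i. w ^ i = 1 \<longleftrightarrow> CARD('a) - 1 dvd i"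
    using finite_field_generator by blast
  obtain t where t: "CARD('a) - 1 = d * t" using assms by blast
  have "t > 0" using two_le_card_field[where ?'a = 'a] t by (cases t) auto
  have unit: "(w ^ t) ^ d = 1" by (simp add: w[unfolded t] mult.commute flip: power_mult)
  have neq: "(w ^ t) ^ i \<noteq> 1" if "0 < i" "i < d" for i
    using that \<open>t > 0\<close> by (auto simp: w[unfolded t] mult.commute[of d] dest: dvd_imp_le simp flip: power_mult)
  show thesis
  proof (cases "w ^ t = a")
    case False
    thus ?thesis using that[of "w ^ t"] unit neq[of 1] assms by simp
  next
    case True
    have "a \<noteq> 0" "a \<noteq> 1" "a ^ 2 \<noteq> 1" "a ^ d = 1"
      using True unit neq[of 1] neq[of 2] assms by (auto simp: power_0_left)
    moreover from this have "a ^ 2 \<noteq> a" by (simp add: power2_eq_square)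
    moreover have "(a ^ 2) ^ d = 1" using \<open>a ^ d = 1\<close> by (metis power_mult mult.commute power_one)
    ultimately show ?thesis using that[of "a ^ 2"] by blast
  qed
qed

section \<open>Coprime exponents and the roots of \<open>h_poly\<close>\<close>

lemma power_gcd_eq_1:
  fixes x :: "'a::field"
  assumes "x ^ m = 1" "x ^ n = 1"
  shows "x ^ gcd m n = 1"
proof (cases "m = 0")
  case False
  \<comment> \<open>Bezout without subtraction requires \<open>m \<noteq> 0\<close>, whence the case
    split.\<close>
  then obtain i j where "m * i = n * j + gcd m n" using bezout_nat by blast
  hence "(x ^ m) ^ i = (x ^ n) ^ j * x ^ gcd m n"
    by (simp flip: power_mult power_add)
  thus ?thesis using assms by simp
qed (use assms in simp)

lemma power_eq_imp_eq_of_coprime: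
  fixes x y :: "'a::field"
  assumes "x \<noteq> 0" "y \<noteq> 0" "x ^ m = y ^ m" "x ^ n = y ^ n" "gcd m n = 1"
  shows "x = y"
  using power_gcd_eq_1[of "x / y" m n] assms by (simp add: power_divide)

lemma poly_h_poly_eq_0:
  fixes y :: "'a::{field,finite}"
  assumes "y ^ d = 1" "y \<noteq> 1"
  shows "poly (h_poly d) y = 0"
  using assms geometric_sum[of y d] by (simp add: h_poly_def poly_sum poly_monom)

section \<open>The permutation criterion\<close>

theorem theorem2p1:
  fixes q d u k :: nat and b :: "'a::{field,finite}" and g f :: "'a poly"
  assumes "q = CARD('a)"
    and "d > 2" and "d dvd q - 1"
    and "u \<ge> 1" and "k \<ge> 0"
    and "h_poly d dvd g"
    and "f = monom 1 u *
               (smult b (monom 1 (k * ((q - 1) div d))) + pcompose g (monom 1 ((q - 1) div d)))"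
  shows "permutation_poly f \<longleftrightarrow>
           gcd u ((q - 1) div d) = 1 \<and>
           gcd d (u + k * ((q - 1) div d)) = 1 \<and>
           b \<noteq> 0 \<and>
           is_nonzero_power d (1 + poly g 1 / b)"
proof -
  define s where "s = (q - 1) div d"
  define r where "r = u + k * s"
  define B where "B = b + poly g 1"
  define \<psi> where "\<psi> y = (if y = 1 then B ^ s else b ^ s * y ^ r)" for y
  have n: "CARD('a) - 1 = d * s" using assms by (simp add: s_def)
  have "s > 0" using two_le_card_field[where ?'a = 'a] n by (cases s) auto
  have unit: "x ^ (d * s) = 1" if "x \<noteq> 0" for x :: 'a
    using power_card_minus_1_eq_1[OF that] n by simp
  have unit_s: "(x ^ s) ^ d = 1" if "x \<noteq> 0" for x :: 'a
    using unit[OF that] by (simp add: mult.commute flip: power_mult)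
  \<comment> \<open>The power criterion is applied with \<open>d\<close> and \<open>s\<close>
    exchanged.\<close>
  have lift: "\<exists>x. x \<noteq> 0 \<and> x ^ s = y" if "y ^ d = 1" for y :: 'a
  proof -
    have "y \<noteq> 0" using that assms(2) by (auto simp: power_0_left)
    hence "is_nonzero_power s y"
      using power_eq_1_iff_is_nonzero_power[of s d y] that n by (simp add: mult.commute)
    thus ?thesis unfolding is_nonzero_power_def by blast
  qed
  have f_eq: "poly f x = x ^ u * (b * (x ^ s) ^ k + poly g (x ^ s))" for x
    by (simp add: assms(7) poly_monom poly_pcompose s_def mult.commute flip: power_mult)
  have f_0: "poly f 0 = 0" using assms(4) by (simp add: f_eq)
  have f_unit: "poly f x = B * x ^ u" if "x ^ s = 1" for x
    using that by (simp add: f_eq B_def)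
  have f_nonunit: "poly f x = b * x ^ r" if "x \<noteq> 0" "x ^ s \<noteq> 1" for x
  proof -
    have "poly g (x ^ s) = 0"
      using assms(6) poly_h_poly_eq_0[OF unit_s that(2)] that(1) by auto
    thus ?thesis by (simp add: f_eq r_def power_add mult.commute flip: power_mult)
  qed
  have f_power: "poly f x ^ s = \<psi> (x ^ s)" if "x \<noteq> 0" for x
  proof (cases "x ^ s = 1")
    case True
    have "(x ^ u) ^ s = (x ^ s) ^ u" by (simp add: mult.commute flip: power_mult)
    thus ?thesis using True by (simp add: f_unit \<psi>_def power_mult_distrib)
  next
    case False
    have "(x ^ r) ^ s = (x ^ s) ^ r" by (simp add: mult.commute flip: power_mult)
    thus ?thesis using False that by (simp add: f_nonunit \<psi>_def power_mult_distrib)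
  qed
  have bij_iff: "permutation_poly f \<longleftrightarrow> inj (poly f)"
    by (auto simp: permutation_poly_def bij_def dest: finite_UNIV_inj_surj[OF finite])
  have power_iff: "is_nonzero_power d (1 + poly g 1 / b) \<longleftrightarrow> B \<noteq> 0 \<and> B ^ s = b ^ s" if "b \<noteq> 0"
  proof -
    have "1 + poly g 1 / b = B / b" using that by (simp add: B_def field_simps)
    thus ?thesis
      using power_eq_1_iff_is_nonzero_power[OF n, of "B / b"] that
      by (auto simp: power_divide)
  qed
  show ?thesis
    unfolding s_def[symmetric] r_def[symmetric]
  proof (intro iffI conjI)
    assume perm: "permutation_poly f"
    hence inj: "inj (poly f)" using bij_iff by simp
    have f_neq_0: "poly f x \<noteq> 0" if "x \<noteq> 0" for x
      using injD[OF inj, of x 0] that f_0 by auto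
    have B: "B \<noteq> 0" using f_neq_0[of 1] f_unit[of 1] by simp
    have "d dvd CARD('a) - 1" using n by simp
    then obtain y1 :: 'a where y1: "y1 ^ d = 1" "y1 \<noteq> 1"
      using ex_root_of_unity_neq_1[of d] assms(2) by (metis not_numeral_less_one)
    then obtain x1 where "x1 \<noteq> 0" "x1 ^ s = y1" using lift by blast
    thus b: "b \<noteq> 0" using f_neq_0[of x1] f_nonunit[of x1] y1 by auto

    \<comment> \<open>Otherwise some \<open>z \<noteq> 1\<close> has \<open>z ^ s = 1\<close>, which
      selects the branch \<open>B * x ^ u\<close>, and \<open>z ^ u = 1\<close>, so \<open>z\<close>
      collides with 1.\<close>
    show "gcd u s = 1"
    proof (rule ccontr)
      assume "gcd u s \<noteq> 1"
      moreover have "gcd u s dvd CARD('a) - 1" unfolding n by simp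
      ultimately obtain z :: 'a where z: "z ^ gcd u s = 1" "z \<noteq> 1"
        using ex_root_of_unity_neq_1 by blast
      have "z ^ u = 1" "z ^ s = 1"
        using z(1) by (metis dvdE gcd_dvd1 gcd_dvd2 power_mult power_one)+
      hence "poly f z = poly f 1" by (simp add: f_unit)
      thus False using inj z(2) by (auto dest: injD)
    qed

    define M :: "'a set" where "M = {y. y ^ d = 1}"
    have in_M: "poly f x ^ s \<in> M" if "x \<noteq> 0" for x
      using unit_s[OF f_neq_0[OF that]] by (simp add: M_def)
    \<comment> \<open>Surjectivity of \<open>poly f\<close> descends along \<open>x ^ s\<close>,
      which reaches all of \<open>M\<close> by \<open>lift\<close>; finiteness of \<open>M\<close>
      then gives injectivity.\<close>
    have "\<psi> ` M = M"
    proof (intro equalityI subsetI)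
      fix t assume "t \<in> \<psi> ` M"
      then obtain y where "y ^ d = 1" "t = \<psi> y" by (auto simp: M_def)
      then obtain x where "x \<noteq> 0" "t = \<psi> (x ^ s)" using lift by blast
      thus "t \<in> M" using in_M f_power by metis
    next
      fix t assume "t \<in> M"
      then obtain v where v: "v \<noteq> 0" "v ^ s = t" using lift by (auto simp: M_def)
      obtain x where x: "v = poly f x"
        using perm by (auto simp: permutation_poly_def bij_def dest: surjD)
      hence "x \<noteq> 0" using v f_0 by auto
      thus "t \<in> \<psi> ` M" using f_power[of x] v x unit_s[of x]
        by (intro image_eqI[of _ _ "x ^ s"]) (auto simp: M_def)
    qed
    hence inj_\<psi>: "inj_on \<psi> M"
      by (intro eq_card_imp_inj_on) auto

    show coprime: "gcd d r = 1"
    proof (rule ccontr)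
      assume "gcd d r \<noteq> 1"
      moreover have "gcd d r dvd CARD('a) - 1" unfolding n by simp
      ultimately obtain z :: 'a where z: "z ^ gcd d r = 1" "z \<noteq> 1"
        using ex_root_of_unity_neq_1 by blast
      have zz: "z ^ d = 1" "z ^ r = 1"
        using z(1) by (metis dvdE gcd_dvd1 gcd_dvd2 power_mult power_one)+
      \<comment> \<open>Avoiding \<open>1 / z\<close> keeps \<open>z * y\<close> away from 1, so
        both \<open>y\<close> and \<open>z * y\<close> fall in the branch
        \<open>b ^ s * y ^ r\<close> of \<open>\<psi>\<close>.\<close>
      obtain y :: 'a where y: "y ^ d = 1" "y \<noteq> 1" "y \<noteq> 1 / z"
        using ex_root_of_unity_avoiding[of d "1 / z"] n assms(2) by auto
      have nz: "z \<noteq> 0" "y \<noteq> 0" using zz y assms(2) by (auto simp: power_0_left)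
      have "z * y \<noteq> 1" using y nz by (auto simp: field_simps)
      hence "\<psi> (z * y) = \<psi> y" using y zz by (simp add: \<psi>_def power_mult_distrib)
      moreover have "z * y \<in> M" "y \<in> M" using y zz by (auto simp: M_def power_mult_distrib)
      ultimately have "z * y = y" using inj_\<psi> by (auto dest: inj_onD)
      thus False using z nz by simp
    qed

    have "B ^ s = b ^ s"
    proof -
      \<comment> \<open>As \<open>i\<close> inverts \<open>r\<close> modulo \<open>d\<close>,
        \<open>c ^ i\<close> is an \<open>r\<close>-th root of \<open>c\<close>. Were it not 1,
        \<open>\<psi>\<close> would send it to \<open>b ^ s * c = B ^ s\<close>, the value at
        1.\<close>
      define c where "c = (B / b) ^ s"
      have c: "c ^ d = 1" unfolding c_def using B b by (intro unit_s) auto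
      have "r \<noteq> 0" using assms(4) by (simp add: r_def)
      then obtain i j where ij: "r * i = d * j + 1"
        using bezout_nat[of r d] coprime by (auto simp: gcd.commute)
      have "(c ^ i) ^ r = c * (c ^ d) ^ j"
        by (metis ij mult.commute power_mult power_add power_one_right)
      hence cr: "(c ^ i) ^ r = c" using c by simp
      have M: "c ^ i \<in> M" "1 \<in> M"
        using c by (auto simp: M_def) (metis power_mult mult.commute power_one)
      have "\<psi> (c ^ i) = \<psi> 1"
        using cr b by (auto simp: \<psi>_def c_def power_divide)
      hence "c ^ i = 1" using inj_\<psi> M by (auto dest: inj_onD)
      hence "c = 1" using cr by simp
      thus ?thesis using b by (simp add: c_def power_divide)
    qed
    thus "is_nonzero_power d (1 + poly g 1 / b)" using power_iff b B by simp
  next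
    assume "gcd u s = 1 \<and> gcd d r = 1 \<and> b \<noteq> 0 \<and> is_nonzero_power d (1 + poly g 1 / b)"
    hence us: "gcd u s = 1" and dr: "gcd d r = 1" and b: "b \<noteq> 0"
      and B: "B \<noteq> 0" "B ^ s = b ^ s" using power_iff by auto
    \<comment> \<open>Equality of \<open>B ^ s\<close> and \<open>b ^ s\<close> removes the
      exception at 1.\<close>
    have \<psi>: "\<psi> y = b ^ s * y ^ r" for y using B by (simp add: \<psi>_def)
    have f_neq_0: "poly f x \<noteq> 0" if "x \<noteq> 0" for x
      using that b B f_unit[of x] f_nonunit[of x] by (cases "x ^ s = 1") auto
    have "x = x'" if eq: "poly f x = poly f x'" and nz: "x \<noteq> 0" "x' \<noteq> 0" for x x'
    proof -
      have "\<psi> (x ^ s) = \<psi> (x' ^ s)" using eq nz f_power by metis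
      hence "(x ^ s) ^ r = (x' ^ s) ^ r" using b by (simp add: \<psi>)
      moreover have "(x ^ s) ^ d = (x' ^ s) ^ d" using unit_s nz by simp
      ultimately have s: "x ^ s = x' ^ s"
        using power_eq_imp_eq_of_coprime[of "x ^ s" "x' ^ s" d r] dr nz by simp
      \<comment> \<open>This factor depends only on \<open>x ^ s\<close>, so it is the same for
        \<open>x\<close> and \<open>x'\<close> and cancels, leaving \<open>u\<close>-th
        powers.\<close>
      have "b * (x ^ s) ^ k + poly g (x ^ s) \<noteq> 0"
        using f_neq_0[OF nz(1)] f_eq[of x] by auto
      hence "x ^ u = x' ^ u" using eq s f_eq by simp
      thus ?thesis using power_eq_imp_eq_of_coprime[of x x' u s] s us nz by simp
    qed
    hence "inj (poly f)"
      using f_0 f_neq_0 by (intro injI) metis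
    thus "permutation_poly f" using bij_iff by simp
  qed
qed

end
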